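(* Let $D\subset\mathbb{C}$ be finite, let $x<y$ be elements of $D\cap\mathbb{Q}$ with $(x,y)\cap D=\varnothing$, and let $N$ be a positive even integer with $xN,yN\in\mathbb{Z}$. Let $w=e_{a_{1}}\cdots e_{a_{k}}$ with $k\ge2$ and $a_{i}\in D$. Then \[\sum_{\substack{1\le i\le k\\ a_{i}\neq x}}\Delta_{N}(e_{a_{i}}\cdots e_{a_{k}}e_{a_{1}}\cdots e_{a_{i-1}}e_{x})+\sum_{\substack{1\le i\le k\\ a_{i}\neq y}}\Delta_{N}(e_{y}e_{a_{i+1}}\cdots e_{a_{k}}e_{a_{1}}\cdots e_{a_{i-1}}e_{a_{i}}) =\sum_{\substack{1\le i\le k\\ a_{i}\notin\{x,y\}}}\Delta_{N}(e_{a_{i}}\cdots e_{a_{k}}e_{a_{1}}\cdots e_{a_{i}})-\sum_{i=1}^{k}\Delta_{N}(e_{a_{1},\ldots,a_{i},a_{i},\ldots,a_{k}}).\]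
   Context: Let $S=\{xN+1,\ldots,yN-1\}$ with the usual order and $\omega_{c}(n)=1/(n-cN)$ for $c\in D$, $n\in S$. For words $u=e_{\mathbf{b}_{1}}\cdots e_{\mathbf{b}_{l}}$ in symbols $e_{b_{1},\ldots,b_{p}}$ ($p\ge1$, $b_{j}\in D$; $e_{b}$ with one index is the usual letter), $\Delta_{N}(u)=\sum_{n_{1}\le\cdots\le n_{l}\in S}\prod_{i=1}^{l}\prod_{b\in\mathbf{b}_{i}}\omega_{b}(n_{i})$ (indices counted with multiplicity; non-strict inequalities). This is the discrete iterated integral $\Delta_{N,(x,y)}((x,+);u;(y,-))$ along the positive straight piece $(x,y)$. Thus $e_{a_{1},\ldots,a_{i},a_{i},\ldots,a_{k}}$ is a single letter whose indices are $a_{1},\ldots,a_{k}$ with $a_{i}$ repeated twice. *)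

theory Defs
  imports Complex_Main
begin

text \<open>A letter \<open>e\<^bsub>b1,...,bp\<^esub>\<close> is the list \<open>[b1, ..., bp]\<close> of its indices (so an index may be
  repeated), and a word is a list of letters.\<close>

type_synonym letter = "complex list"
type_synonym word = "letter list"

definition omega :: "nat \<Rightarrow> complex \<Rightarrow> int \<Rightarrow> complex" where
  "omega N c n = 1 / (of_int n - c * of_nat N)"

text \<open>When \<open>x * N\<close> and \<open>y * N\<close> are integers, this is \<open>{xN+1, ..., yN-1}\<close>.\<close>

definition summation_range :: "nat \<Rightarrow> real \<Rightarrow> real \<Rightarrow> int set" where
  "summation_range N x y =
     {n. x * real N + 1 \<le> real_of_int n \<and> real_of_int n \<le> y * real N - 1}"

definition Delta :: "nat \<Rightarrow> real \<Rightarrow> real \<Rightarrow> word \<Rightarrow> complex" where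
  "Delta N x y u =
     (\<Sum>ns \<in> {ns. length ns = length u \<and> set ns \<subseteq> summation_range N x y \<and> sorted ns}.
        \<Prod>i<length u. \<Prod>b\<leftarrow>u ! i. omega N b (ns ! i))"

text \<open>The word \<open>e\<^bsub>a i\<^esub> ... e\<^bsub>a j\<^esub>\<close> of one-index letters; it is empty if \<open>j < i\<close>.\<close>

definition seg :: "(nat \<Rightarrow> complex) \<Rightarrow> nat \<Rightarrow> nat \<Rightarrow> word" where
  "seg a i j = map (\<lambda>m. [a m]) [i..<Suc j]"

end

theory Submission
  imports Defs
begin

text \<open>Partial fractions give \<open>(\<omega>\<^sub>a(n) - \<omega>\<^sub>a(m)) / (m - n) = \<omega>\<^sub>a(n) \<omega>\<^sub>a(m)\<close> for \<open>n \<noteq> m\<close>. Attach the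
  factor \<open>1 / (m - n)\<close> to a chain \<open>n = n\<^sub>1 \<le> \<dots> \<le> n\<^sub>k \<le> m\<close> weighted by a rotation
  \<open>e\<^bsub>a i\<^esub> \<dots> e\<^bsub>a (i-1)\<^esub>\<close> of the word. Moving the form \<open>\<omega>\<^bsub>a i\<^esub>\<close> from \<open>n\<close> to \<open>m\<close> costs
  \<open>\<Delta>(e\<^bsub>a i\<^esub> \<dots> e\<^bsub>a i\<^esub>)\<close> minus its diagonal part \<open>n = m\<close>. The resulting sum and the connected sum of
  the next rotation run over the same weighted chains \<open>p \<le> \<dots> \<le> q\<close>, and differ only in a free
  variable below \<open>p\<close> or above \<open>q\<close>; summing that variable out, the difference of the two harmonic
  sums is \<open>\<Sum>\<^bsub>n \<le> p\<^esub> \<omega>\<^sub>y(n) + \<Sum>\<^bsub>m \<ge> q\<^esub> \<omega>\<^sub>x(m)\<close>. Adding up over all rotations, the connected sums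
  cancel; the restrictions on \<open>i\<close> remove the same terms from both sides.\<close>

section \<open>Sums over weakly increasing chains of integers\<close>

text \<open>Letters are replaced by arbitrary functions and the range by an arbitrary set, so that
  fixing the smallest index \<open>j\<close> leaves a sum of the same kind over
  \<open>S \<inter> {j..}\<close>.\<close>

definition sorted_sum :: "int set \<Rightarrow> (int \<Rightarrow> complex) list \<Rightarrow> complex" where
  "sorted_sum S us =
     (\<Sum>ns | length ns = length us \<and> set ns \<subseteq> S \<and> sorted ns. \<Prod>i<length us. (us ! i) (ns ! i))"

text \<open>The endpoints \<open>n\<close> and \<open>m\<close> are fixed and carry no weight, so a
  form can be attached to either of them.\<close>

primrec chain_sum :: "int set \<Rightarrow> (int \<Rightarrow> complex) list \<Rightarrow> int \<Rightarrow> int \<Rightarrow> complex" where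
  "chain_sum S [] n m = (if n \<le> m then 1 else 0)"
| "chain_sum S (u # us) n m = (\<Sum>j\<in>S. if n \<le> j then u j * chain_sum S us j m else 0)"

text \<open>Diagonal terms \<open>n = m\<close> vanish because \<open>1 / 0 = 0\<close>.\<close>

definition connected_sum :: "int set \<Rightarrow> (int \<Rightarrow> complex) list \<Rightarrow> complex" where
  "connected_sum S us =
     (\<Sum>n\<in>S. \<Sum>m\<in>S. hd us n * chain_sum S (tl us) n m / of_int (m - n))"

lemma sorted_sum_Nil [simp]: "sorted_sum S [] = 1"
proof -
  have "{ns :: int list. length ns = length ([] :: (int \<Rightarrow> complex) list) \<and> set ns \<subseteq> S \<and> sorted ns}
      = {[]}"
    by auto
  then show ?thesis
    by (simp add: sorted_sum_def)
qed

text \<open>The head of a sorted list is its minimum, so the tail is any sorted list with entries in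
  \<open>S \<inter> {j..}\<close>.\<close>

lemma sorted_sum_Cons:
  assumes "finite S"
  shows "sorted_sum S (u # us) = (\<Sum>j\<in>S. u j * sorted_sum (S \<inter> {j..}) us)"
proof -
  let ?A = "\<lambda>j. {ns. length ns = length us \<and> set ns \<subseteq> S \<inter> {j..} \<and> sorted ns}"
  have fin: "finite (?A j)" for j
    by (rule finite_subset[OF _ finite_lists_length_eq[of S "length us"]]) (use assms in auto)
  have img: "{ns. length ns = length (u # us) \<and> set ns \<subseteq> S \<and> sorted ns}
      = (\<lambda>(j, ns). j # ns) ` Sigma S ?A" (is "?L = ?R")
  proof
    show "?L \<subseteq> ?R"
    proof
      fix ns assume ns: "ns \<in> ?L"
      then obtain j ms where "ns = j # ms"
        by (cases ns) auto
      with ns have "(j, ms) \<in> Sigma S ?A"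
        by auto
      with \<open>ns = j # ms\<close> show "ns \<in> ?R"
        by force
    qed
  qed auto
  have inj: "inj_on (\<lambda>(j, ns). j # ns) (Sigma S ?A)"
    by (auto simp: inj_on_def)
  have "sorted_sum S (u # us)
      = (\<Sum>(j, ns)\<in>Sigma S ?A. \<Prod>i<length (u # us). ((u # us) ! i) ((j # ns) ! i))"
    unfolding sorted_sum_def img sum.reindex[OF inj] by (simp add: case_prod_unfold)
  also have "\<dots> = (\<Sum>(j, ns)\<in>Sigma S ?A. u j * (\<Prod>i<length us. (us ! i) (ns ! i)))"
    by (simp only: length_Cons prod.lessThan_Suc_shift nth_Cons_0 nth_Cons_Suc)
  also have "\<dots> = (\<Sum>j\<in>S. u j * sorted_sum (S \<inter> {j..}) us)"
    by (subst sum.Sigma[symmetric]) (use assms fin in \<open>auto simp: sorted_sum_def sum_distrib_left\<close>)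
  finally show ?thesis .
qed

text \<open>The last index serves as the upper endpoint of a chain. The lower bound \<open>n\<close>
  varies because the induction replaces it by the first index.\<close>

lemma sorted_sum_snoc_atLeast:
  assumes "finite S"
  shows "sorted_sum (S \<inter> {n..}) (us @ [v]) = (\<Sum>m\<in>S. chain_sum S us n m * v m)"
proof (induction us arbitrary: n)
  case Nil
  have "sorted_sum (S \<inter> {n..}) ([] @ [v]) = (\<Sum>m\<in>S \<inter> {n..}. v m)"
    using assms by (simp add: sorted_sum_Cons)
  also have "\<dots> = (\<Sum>m\<in>S. if m \<in> {n..} then v m else 0)"
    by (rule sum.inter_restrict[OF assms])
  finally show ?case
    by (simp add: if_distrib[of "\<lambda>z. z * _"] cong: if_cong)
next
  case (Cons u us)
  have "S \<inter> {n..} \<inter> {j..} = S \<inter> {j..}" if "n \<le> j" for j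
    using that by auto
  then have "sorted_sum (S \<inter> {n..}) ((u # us) @ [v])
      = (\<Sum>j\<in>S \<inter> {n..}. u j * sorted_sum (S \<inter> {j..}) (us @ [v]))"
    using assms by (simp add: sorted_sum_Cons)
  also have "\<dots> = (\<Sum>j\<in>S. if j \<in> {n..} then u j * sorted_sum (S \<inter> {j..}) (us @ [v]) else 0)"
    by (rule sum.inter_restrict[OF assms])
  also have "\<dots> = (\<Sum>j\<in>S. \<Sum>m\<in>S. (if n \<le> j then u j * chain_sum S us j m else 0) * v m)"
    by (rule sum.cong) (auto simp: Cons.IH sum_distrib_left mult.assoc)
  also have "\<dots> = (\<Sum>m\<in>S. chain_sum S (u # us) n m * v m)"
    by (subst sum.swap) (simp add: sum_distrib_right)
  finally show ?case .
qed

lemma sorted_sum_Cons_snoc: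
  assumes "finite S"
  shows "sorted_sum S (u # us @ [v]) = (\<Sum>n\<in>S. \<Sum>m\<in>S. u n * chain_sum S us n m * v m)"
  using assms by (simp add: sorted_sum_Cons sorted_sum_snoc_atLeast sum_distrib_left mult.assoc)

lemma sorted_sum_single: "finite S \<Longrightarrow> sorted_sum S [u] = (\<Sum>n\<in>S. u n)"
  by (simp add: sorted_sum_Cons)

lemma chain_sum_eq_0: "m < n \<Longrightarrow> chain_sum S us n m = 0"
  by (induction us arbitrary: n) (auto intro!: sum.neutral)

text \<open>A weakly increasing chain from \<open>n\<close> to \<open>n\<close> is constant.\<close>

lemma chain_sum_diag:
  assumes "finite S" "n \<in> S"
  shows "chain_sum S us n n = (\<Prod>u\<leftarrow>us. u n)"
proof (induction us)
  case (Cons u us)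
  have "chain_sum S (u # us) n n = (\<Sum>j\<in>S. if j = n then u j * chain_sum S us j n else 0)"
    unfolding chain_sum.simps by (rule sum.cong) (auto simp: chain_sum_eq_0)
  with assms Cons show ?case
    by simp
qed simp

text \<open>The definition peels off forms at the lower end; this is the recursion at the upper end,
  needed to sum out a free upper endpoint.\<close>

lemma chain_sum_snoc:
  "chain_sum S (us @ [v]) n m = (\<Sum>q\<in>S. chain_sum S us n q * (if q \<le> m then v q else 0))"
proof (induction us arbitrary: n)
  case Nil
  show ?case
    by (auto intro!: sum.cong)
next
  case (Cons u us)
  have "chain_sum S ((u # us) @ [v]) n m
      = (\<Sum>j\<in>S. \<Sum>q\<in>S. (if n \<le> j then u j * chain_sum S us j q else 0) * (if q \<le> m then v q else 0))"
    unfolding append_Cons chain_sum.simps Cons.IH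
    by (rule sum.cong) (auto simp: sum_distrib_left mult.assoc)
  also have "\<dots> = (\<Sum>q\<in>S. chain_sum S (u # us) n q * (if q \<le> m then v q else 0))"
    by (subst sum.swap) (simp add: sum_distrib_right)
  finally show ?case .
qed

section \<open>Moving a form from the lower to the upper endpoint\<close>

text \<open>The identity holds for each pair \<open>n\<close>, \<open>m\<close>: off the diagonal it
  is \<open>pf\<close> times the chain weight. On the diagonal the left side is 0 by division by
  zero, and the right side cancels by \<open>chain_sum_diag\<close>.\<close>

lemma connected_sum_transport:
  assumes "finite S"
    and pf: "\<And>n m. n \<in> S \<Longrightarrow> m \<in> S \<Longrightarrow> n \<noteq> m \<Longrightarrow> (u n - u m) / of_int (m - n) = u n * u m"
  shows "connected_sum S (u # us) - (\<Sum>n\<in>S. \<Sum>m\<in>S. chain_sum S us n m * u m / of_int (m - n))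
       = sorted_sum S (u # us @ [u]) - (\<Sum>n\<in>S. u n * u n * (\<Prod>v\<leftarrow>us. v n))"
proof -
  have eq: "u n * chain_sum S us n m / of_int (m - n) - chain_sum S us n m * u m / of_int (m - n)
      = u n * chain_sum S us n m * u m - (if n = m then u n * u n * (\<Prod>v\<leftarrow>us. v n) else 0)"
    if "n \<in> S" "m \<in> S" for n m
  proof (cases "n = m")
    case True
    with assms(1) that show ?thesis
      by (simp add: chain_sum_diag)
  next
    case False
    have "u n * chain_sum S us n m / of_int (m - n) - chain_sum S us n m * u m / of_int (m - n)
        = chain_sum S us n m * ((u n - u m) / of_int (m - n))"
      by (simp add: diff_divide_distrib algebra_simps)
    with pf[OF that False] False show ?thesis
      by simp
  qed
  have "(\<Sum>n\<in>S. u n * u n * (\<Prod>v\<leftarrow>us. v n))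
      = (\<Sum>n\<in>S. \<Sum>m\<in>S. if n = m then u n * u n * (\<Prod>v\<leftarrow>us. v n) else 0)"
    using assms(1) by simp
  then show ?thesis
    unfolding connected_sum_def sorted_sum_Cons_snoc[OF assms(1)] list.sel
    by (simp only: sum_subtractf[symmetric] eq cong: sum.cong)
qed

section \<open>Summing out the free endpoint\<close>

text \<open>All four sums are pieces of the sum of \<open>1 / j\<close> over
  \<open>{q-p..Y-X-1}\<close>, split once at \<open>Y - p\<close> and once at \<open>q - X\<close>.
  If \<open>p = q\<close>, the term \<open>j = 0\<close> occurs and is 0.\<close>

lemma harmonic_difference:
  fixes X Y p q :: int
  assumes "X < p" "p \<le> q" "q < Y"
  shows "(\<Sum>m=q..Y-1. 1 / of_int (m - p)) - (\<Sum>n=X+1..p. 1 / of_int (q - n))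
       = (\<Sum>n=X+1..p. 1 / of_int (n - Y)) + (\<Sum>m=q..Y-1. 1 / (of_int (m - X) :: complex))"
proof -
  let ?h = "\<lambda>j::int. 1 / (of_int j :: complex)"
  have 1: "(\<Sum>m=q..Y-1. ?h (m - p)) = (\<Sum>j=q-p..Y-p-1. ?h j)"
    by (rule sum.reindex_bij_witness[of _ "\<lambda>j. j + p" "\<lambda>m. m - p"]) auto
  have 2: "(\<Sum>n=X+1..p. ?h (q - n)) = (\<Sum>j=q-p..q-X-1. ?h j)"
    by (rule sum.reindex_bij_witness[of _ "\<lambda>j. q - j" "\<lambda>n. q - n"]) auto
  have 3: "(\<Sum>n=X+1..p. ?h (n - Y)) = - (\<Sum>j=Y-p..Y-X-1. ?h j)"
  proof -
    have "?h (n - Y) = - ?h (Y - n)" for n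
      by (metis minus_diff_eq of_int_minus divide_minus_right)
    then have "(\<Sum>n=X+1..p. ?h (n - Y)) = - (\<Sum>n=X+1..p. ?h (Y - n))"
      by (simp only: sum_negf)
    also have "(\<Sum>n=X+1..p. ?h (Y - n)) = (\<Sum>j=Y-p..Y-X-1. ?h j)"
      by (rule sum.reindex_bij_witness[of _ "\<lambda>j. Y - j" "\<lambda>n. Y - n"]) auto
    finally show ?thesis .
  qed
  have 4: "(\<Sum>m=q..Y-1. ?h (m - X)) = (\<Sum>j=q-X..Y-X-1. ?h j)"
    by (rule sum.reindex_bij_witness[of _ "\<lambda>j. j + X" "\<lambda>m. m - X"]) auto
  have "{q-p..Y-X-1} = {q-p..Y-p-1} \<union> {Y-p..Y-X-1}"
    using assms by auto
  then have 5: "(\<Sum>j=q-p..Y-X-1. ?h j) = (\<Sum>j=q-p..Y-p-1. ?h j) + (\<Sum>j=Y-p..Y-X-1. ?h j)"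
    by (simp only:) (rule sum.union_disjoint, auto)
  have "{q-p..Y-X-1} = {q-p..q-X-1} \<union> {q-X..Y-X-1}"
    using assms by auto
  then have 6: "(\<Sum>j=q-p..Y-X-1. ?h j) = (\<Sum>j=q-p..q-X-1. ?h j) + (\<Sum>j=q-X..Y-X-1. ?h j)"
    by (simp only:) (rule sum.union_disjoint, auto)
  show ?thesis
    unfolding 1 2 3 4 using 5 6 by (simp add: algebra_simps)
qed

text \<open>In the connected sum the last form \<open>v\<close> sits at some \<open>q\<close> below
  the free endpoint \<open>m\<close>; in the subtracted sum the first form sits at some
  \<open>p\<close> above the free endpoint \<open>n\<close>. Both thus run over the same chains from
  \<open>p\<close> to \<open>q\<close>, and \<open>harmonic_difference\<close> compares the factors
  left by the free endpoint.\<close>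

lemma connected_sum_shift:
  fixes X Y :: int
  defines "S \<equiv> {X+1..Y-1}"
  assumes "us \<noteq> []"
  shows "connected_sum S (us @ [v]) - (\<Sum>n\<in>S. \<Sum>m\<in>S. chain_sum S us n m * v m / of_int (m - n))
       = sorted_sum S ((\<lambda>n. 1 / of_int (n - Y)) # us @ [v])
         + sorted_sum S (us @ [v] @ [\<lambda>m. 1 / of_int (m - X)])"
proof -
  have fin: "finite S"
    by (simp add: S_def)
  obtain u ws where us: "us = u # ws"
    using assms by (cases us) auto
  \<comment> \<open>Total weight of the chains whose first form sits at \<open>p\<close> and last
    form at \<open>q\<close>.\<close>
  define c where "c p q = u p * chain_sum S ws p q * v q" for p q
  have below: "(\<Sum>n\<in>S. if n \<le> p then f n else 0) = (\<Sum>n=X+1..p. f n)"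
    if "p \<in> S" for p and f :: "int \<Rightarrow> complex"
    by (rule sum.mono_neutral_cong_right) (use that in \<open>auto simp: S_def\<close>)
  have above: "(\<Sum>m\<in>S. if q \<le> m then f m else 0) = (\<Sum>m=q..Y-1. f m)"
    if "q \<in> S" for q and f :: "int \<Rightarrow> complex"
    by (rule sum.mono_neutral_cong_right) (use that in \<open>auto simp: S_def\<close>)
  \<comment> \<open>The kernel \<open>g\<close> is kept general: \<open>lower\<close> and
    \<open>upper\<close> serve both for the connecting factor and for the forms at the two ends of
    the range.\<close>
  have lower: "(\<Sum>n\<in>S. \<Sum>q\<in>S. chain_sum S us n q * v q * g n q)
      = (\<Sum>p\<in>S. \<Sum>q\<in>S. c p q * (\<Sum>n=X+1..p. g n q))" for g
  proof -
    have "(\<Sum>n\<in>S. \<Sum>q\<in>S. chain_sum S us n q * v q * g n q)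
        = (\<Sum>n\<in>S. \<Sum>q\<in>S. \<Sum>p\<in>S. c p q * (if n \<le> p then g n q else 0))"
      unfolding us chain_sum.simps sum_distrib_right c_def
      by (intro sum.cong refl) auto
    also have "\<dots> = (\<Sum>q\<in>S. \<Sum>n\<in>S. \<Sum>p\<in>S. c p q * (if n \<le> p then g n q else 0))"
      by (rule sum.swap)
    also have "\<dots> = (\<Sum>q\<in>S. \<Sum>p\<in>S. \<Sum>n\<in>S. c p q * (if n \<le> p then g n q else 0))"
      by (rule sum.cong[OF refl], rule sum.swap)
    also have "\<dots> = (\<Sum>p\<in>S. \<Sum>q\<in>S. c p q * (\<Sum>n\<in>S. if n \<le> p then g n q else 0))"
      by (subst sum.swap) (simp only: sum_distrib_left)
    finally show ?thesis
      by (simp add: below)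
  qed
  have upper: "(\<Sum>p\<in>S. \<Sum>m\<in>S. u p * chain_sum S (ws @ [v]) p m * g p m)
      = (\<Sum>p\<in>S. \<Sum>q\<in>S. c p q * (\<Sum>m=q..Y-1. g p m))" for g
  proof -
    have "(\<Sum>p\<in>S. \<Sum>m\<in>S. u p * chain_sum S (ws @ [v]) p m * g p m)
        = (\<Sum>p\<in>S. \<Sum>m\<in>S. \<Sum>q\<in>S. c p q * (if q \<le> m then g p m else 0))"
      unfolding chain_sum_snoc sum_distrib_right sum_distrib_left c_def
      by (intro sum.cong refl) auto
    also have "\<dots> = (\<Sum>p\<in>S. \<Sum>q\<in>S. \<Sum>m\<in>S. c p q * (if q \<le> m then g p m else 0))"
      by (rule sum.cong[OF refl], rule sum.swap)
    also have "\<dots> = (\<Sum>p\<in>S. \<Sum>q\<in>S. c p q * (\<Sum>m\<in>S. if q \<le> m then g p m else 0))"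
      by (simp only: sum_distrib_left)
    finally show ?thesis
      by (simp add: above)
  qed
  have "connected_sum S (us @ [v]) - (\<Sum>n\<in>S. \<Sum>m\<in>S. chain_sum S us n m * v m / of_int (m - n))
      = (\<Sum>p\<in>S. \<Sum>q\<in>S. c p q * (\<Sum>m=q..Y-1. 1 / of_int (m - p)))
        - (\<Sum>p\<in>S. \<Sum>q\<in>S. c p q * (\<Sum>n=X+1..p. 1 / of_int (q - n)))"
    using lower[of "\<lambda>n q. 1 / of_int (q - n)"] upper[of "\<lambda>p m. 1 / of_int (m - p)"]
    by (simp add: connected_sum_def us)
  also have "\<dots> = (\<Sum>p\<in>S. \<Sum>q\<in>S. c p q *
      ((\<Sum>m=q..Y-1. 1 / of_int (m - p)) - (\<Sum>n=X+1..p. 1 / of_int (q - n))))"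
    by (simp only: sum_subtractf right_diff_distrib)
  also have "\<dots> = (\<Sum>p\<in>S. \<Sum>q\<in>S. c p q *
      ((\<Sum>n=X+1..p. 1 / of_int (n - Y)) + (\<Sum>m=q..Y-1. 1 / of_int (m - X))))"
  proof (intro sum.cong refl)
    fix p q assume "p \<in> S" "q \<in> S"
    show "c p q * ((\<Sum>m=q..Y-1. 1 / of_int (m - p)) - (\<Sum>n=X+1..p. 1 / of_int (q - n)))
        = c p q * ((\<Sum>n=X+1..p. 1 / of_int (n - Y)) + (\<Sum>m=q..Y-1. 1 / of_int (m - X)))"
    proof (cases "p \<le> q")
      case True
      have "X < p" "q < Y"
        using \<open>p \<in> S\<close> \<open>q \<in> S\<close> by (auto simp: S_def)
      then show ?thesis
        by (simp only: harmonic_difference[OF _ True])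
    next
      case False
      then show ?thesis
        by (simp add: c_def chain_sum_eq_0)
    qed
  qed
  also have "\<dots> = (\<Sum>p\<in>S. \<Sum>q\<in>S. c p q * (\<Sum>n=X+1..p. 1 / of_int (n - Y)))
      + (\<Sum>p\<in>S. \<Sum>q\<in>S. c p q * (\<Sum>m=q..Y-1. 1 / of_int (m - X)))"
    by (simp only: sum.distrib distrib_left)
  also have "\<dots> = (\<Sum>n\<in>S. \<Sum>q\<in>S. 1 / of_int (n - Y) * chain_sum S us n q * v q)
      + (\<Sum>p\<in>S. \<Sum>m\<in>S. u p * chain_sum S (ws @ [v]) p m * (1 / of_int (m - X)))"
    \<comment> \<open>Read backwards, the two formulas restore the free variable as a first or last
      index, now weighted by the form belonging to \<open>Y\<close> or \<open>X\<close>.\<close>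
    unfolding lower[symmetric] upper[symmetric] by (simp add: mult_ac)
  also have "\<dots> = sorted_sum S ((\<lambda>n. 1 / of_int (n - Y)) # us @ [v])
      + sorted_sum S (us @ [v] @ [\<lambda>m. 1 / of_int (m - X)])"
    using sorted_sum_Cons_snoc[OF fin, of u "ws @ [v]" "\<lambda>m. 1 / of_int (m - X)"]
      sorted_sum_Cons_snoc[OF fin, of "\<lambda>n. 1 / of_int (n - Y)" us v]
    by (simp add: us del: chain_sum.simps)
  finally show ?thesis .
qed

section \<open>Words as lists of weights, and nonvanishing denominators\<close>

definition weight :: "nat \<Rightarrow> letter \<Rightarrow> int \<Rightarrow> complex" where
  "weight N l n = (\<Prod>b\<leftarrow>l. omega N b n)"

lemma Delta_eq_sorted_sum:
  "Delta N x y w = sorted_sum (summation_range N x y) (map (weight N) w)"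
  by (simp add: Delta_def sorted_sum_def weight_def)

lemma omega_partial_fraction:
  assumes "of_int n \<noteq> c * of_nat N" "of_int m \<noteq> c * of_nat N" "n \<noteq> m"
  shows "(omega N c n - omega N c m) / of_int (m - n) = omega N c n * omega N c m"
proof -
  have "of_int n - c * of_nat N \<noteq> 0" "of_int m - c * of_nat N \<noteq> 0" "of_int (m - n) \<noteq> (0::complex)"
    using assms by simp_all
  then show ?thesis
    unfolding omega_def by (simp add: divide_simps)
qed

text \<open>A zero denominator would give \<open>c = n / N\<close>, a point of \<open>D\<close>
  strictly between \<open>x\<close> and \<open>y\<close>.\<close>

lemma of_int_ne_of_gap:
  assumes "c \<in> D" "complex_of_real ` {x<..<y} \<inter> D = {}" "N > 0" "n \<in> summation_range N x y"
  shows "of_int n \<noteq> c * of_nat N"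
proof
  assume "of_int n = c * of_nat N"
  with \<open>N > 0\<close> have "c = complex_of_real (real_of_int n / real N)"
    by (simp add: field_simps)
  moreover have "real_of_int n / real N \<in> {x<..<y}"
    using assms(3,4) by (auto simp: summation_range_def field_simps)
  ultimately show False
    using assms(1,2) by blast
qed

section \<open>Summation over the rotations of the word\<close>

lemma sum_cyclic_shift:
  fixes f :: "nat \<Rightarrow> 'a::comm_monoid_add"
  assumes "k \<ge> 1" "\<And>i. 1 \<le> i \<Longrightarrow> i < k \<Longrightarrow> g i = f (Suc i)" "g k = f 1"
  shows "(\<Sum>i=1..k. g i) = (\<Sum>i=1..k. f i)"
proof -
  obtain j where k: "k = Suc j"
    using assms(1) by (cases k) auto
  have "(\<Sum>i=1..k. g i) = (\<Sum>i=1..j. f (Suc i)) + f 1"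
    using assms k by simp
  also have "\<dots> = (\<Sum>i=1..k. f i)"
    unfolding k using sum.atLeast_Suc_atMost[of 1 "Suc j" f] sum.shift_bounds_cl_Suc_ivl[of f 1 j]
    by (simp add: add.commute)
  finally show ?thesis .
qed

lemma seg_eq_Cons: "i \<le> j \<Longrightarrow> seg a i j = [a i] # seg a (Suc i) j"
  by (simp add: seg_def upt_conv_Cons del: upt_Suc)

lemma seg_eq_snoc: "1 \<le> j \<Longrightarrow> i \<le> j \<Longrightarrow> seg a i j = seg a i (j - 1) @ [[a j]]"
  by (cases j) (simp_all add: seg_def)

text \<open>The identity with \<open>i\<close> running over all of \<open>{1..k}\<close>; the gap in
  \<open>D\<close> enters through \<open>nz\<close>.\<close>

lemma cyclic_sum_unrestricted:
  fixes x y :: real and a :: "nat \<Rightarrow> complex"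
  assumes "x * real N \<in> \<int>" "y * real N \<in> \<int>" "k \<ge> 2"
    and nz: "\<And>i n. i \<in> {1..k} \<Longrightarrow> n \<in> summation_range N x y \<Longrightarrow> of_int n \<noteq> a i * of_nat N"
  shows "(\<Sum>i=1..k. Delta N x y (seg a i k @ seg a 1 (i - 1) @ [[complex_of_real x]]))
       + (\<Sum>i=1..k. Delta N x y ([[complex_of_real y]] @ seg a (i + 1) k @ seg a 1 (i - 1) @ [[a i]]))
       = (\<Sum>i=1..k. Delta N x y (seg a i k @ seg a 1 i))
       - (\<Sum>i=1..k. Delta N x y [map a [1..<Suc i] @ map a [i..<Suc k]])"
proof -
  obtain X Y :: int where XY: "x * real N = of_int X" "y * real N = of_int Y"
    using assms(1,2) by (auto elim!: Ints_cases)
  define S where "S = summation_range N x y"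
  have S: "S = {X+1..Y-1}"
    unfolding S_def summation_range_def XY by auto
  then have fin: "finite S"
    by simp
  \<comment> \<open>The rotation starting at \<open>a i\<close> without its first letter:
    \<open>[a i] # rest i\<close> is that rotation, and \<open>rest i @ [[a i]]\<close> is the next
    one.\<close>
  define rest where "rest i = seg a (i + 1) k @ seg a 1 (i - 1)" for i
  define W where "W = map (weight N)"
  \<comment> \<open>The intermediate sum, after the form of \<open>a i\<close> has moved from
    \<open>n\<close> to \<open>m\<close>.\<close>
  define Q where "Q i = (\<Sum>n\<in>S. \<Sum>m\<in>S. chain_sum S (W (rest i)) n m * weight N [a i] m / of_int (m - n))" for i
  have seg_head: "seg a i k = [a i] # seg a (i + 1) k" if "i \<in> {1..k}" for i
    using that by (simp add: seg_eq_Cons)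
  have seg_last: "seg a 1 i = seg a 1 (i - 1) @ [[a i]]" if "i \<in> {1..k}" for i
    using that by (simp add: seg_eq_snoc)
  have rot: "seg a i k @ seg a 1 (i - 1) = [a i] # rest i" if "i \<in> {1..k}" for i
    using seg_head[OF that] by (simp add: rest_def)
  \<comment> \<open>Since \<open>k \<ge> 2\<close>, at least one letter remains, as
    \<open>connected_sum_shift\<close> requires.\<close>
  have "length (rest i) = k - 1" if "i \<in> {1..k}" for i
    using that by (auto simp: rest_def seg_def)
  then have rest_ne: "W (rest i) \<noteq> []" if "i \<in> {1..k}" for i
    using that assms(3) by (fastforce simp: W_def)
  have step: "rest i @ [[a i]] = [a (Suc i)] # rest (Suc i)" if "1 \<le> i" "i < k" for i
    using seg_head[of "Suc i"] seg_last[of i] that by (simp add: rest_def)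
  have wrap: "rest k @ [[a k]] = [a 1] # rest 1"
    using seg_last[of k] seg_head[of 1] assms(3) by (simp add: rest_def seg_def del: upt_Suc)
  have shift: "(\<Sum>i=1..k. F (rest i @ [[a i]])) = (\<Sum>i=1..k. F ([a i] # rest i))"
    for F :: "word \<Rightarrow> complex"
    by (rule sum_cyclic_shift) (use assms(3) step wrap in auto)
  have wx: "weight N [complex_of_real x] = (\<lambda>m. 1 / of_int (m - X))"
    using arg_cong[OF XY(1), of complex_of_real] by (simp add: weight_def omega_def fun_eq_iff)
  have wy: "weight N [complex_of_real y] = (\<lambda>m. 1 / of_int (m - Y))"
    using arg_cong[OF XY(2), of complex_of_real] by (simp add: weight_def omega_def fun_eq_iff)
  \<comment> \<open>A one-letter word has a single index \<open>n\<close>, where \<open>a i\<close>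
    counts twice and every other letter once.\<close>
  have diag: "Delta N x y [map a [1..<Suc i] @ map a [i..<Suc k]]
      = (\<Sum>n\<in>S. weight N [a i] n * weight N [a i] n * (\<Prod>v\<leftarrow>W (rest i). v n))"
    if "i \<in> {1..k}" for i
  proof -
    have "[1..<Suc i] = [1..<Suc (i - 1)] @ [i]"
      using that by (cases i) simp_all
    moreover have "[i..<Suc k] = i # [Suc i..<Suc k]"
      using that by (simp add: upt_conv_Cons del: upt_Suc)
    ultimately have "weight N (map a [1..<Suc i] @ map a [i..<Suc k]) n
        = weight N [a i] n * weight N [a i] n * (\<Prod>v\<leftarrow>W (rest i). v n)" for n
      by (simp add: weight_def W_def rest_def seg_def comp_def mult_ac del: upt_Suc)
    then show ?thesis
      using fin by (simp add: Delta_eq_sorted_sum sorted_sum_single flip: S_def)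
  qed
  have transport: "connected_sum S (W ([a i] # rest i)) - Q i
      = Delta N x y (seg a i k @ seg a 1 i) - Delta N x y [map a [1..<Suc i] @ map a [i..<Suc k]]"
    if "i \<in> {1..k}" for i
  proof -
    have "(weight N [a i] n - weight N [a i] m) / of_int (m - n) = weight N [a i] n * weight N [a i] m"
      if "n \<in> S" "m \<in> S" "n \<noteq> m" for n m
      using omega_partial_fraction[OF nz nz] that \<open>i \<in> {1..k}\<close> by (simp add: weight_def S_def)
    moreover have "seg a i k @ seg a 1 i = [a i] # rest i @ [[a i]]"
      using seg_head[OF that] seg_last[OF that] by (simp add: rest_def)
    ultimately show ?thesis
      using connected_sum_transport[OF fin, of "weight N [a i]" "W (rest i)"]
      unfolding diag[OF that] by (simp add: Q_def W_def Delta_eq_sorted_sum flip: S_def)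
  qed
  have next_rot: "connected_sum S (W (rest i @ [[a i]])) - Q i
      = Delta N x y ([[complex_of_real y]] @ rest i @ [[a i]])
        + Delta N x y ((rest i @ [[a i]]) @ [[complex_of_real x]])"
    if "i \<in> {1..k}" for i
    using connected_sum_shift[OF rest_ne[OF that], of X Y "weight N [a i]"]
    by (simp add: Q_def W_def Delta_eq_sorted_sum wx wy flip: S_def S)
  have "(\<Sum>i=1..k. Delta N x y (seg a i k @ seg a 1 (i - 1) @ [[complex_of_real x]]))
       + (\<Sum>i=1..k. Delta N x y ([[complex_of_real y]] @ seg a (i + 1) k @ seg a 1 (i - 1) @ [[a i]]))
      = (\<Sum>i=1..k. Delta N x y (([a i] # rest i) @ [[complex_of_real x]]))
       + (\<Sum>i=1..k. Delta N x y ([[complex_of_real y]] @ rest i @ [[a i]]))"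
    using rot by (intro arg_cong2[of _ _ _ _ "(+)"] sum.cong refl)
      (simp_all add: rest_def flip: append_assoc append_Cons)
  also have "\<dots> = (\<Sum>i=1..k. connected_sum S (W (rest i @ [[a i]])) - Q i)"
    using next_rot shift[of "\<lambda>w. Delta N x y (w @ [[complex_of_real x]])"]
    by (simp add: sum.distrib)
  \<comment> \<open>Only the connected sums are reindexed cyclically; \<open>Q i\<close> stays in
    place, so that \<open>transport\<close> applies.\<close>
  also have "\<dots> = (\<Sum>i=1..k. connected_sum S (W ([a i] # rest i)) - Q i)"
    using shift[of "\<lambda>w. connected_sum S (W w)"] by (simp add: sum_subtractf)
  also have "\<dots> = (\<Sum>i=1..k. Delta N x y (seg a i k @ seg a 1 i))
       - (\<Sum>i=1..k. Delta N x y [map a [1..<Suc i] @ map a [i..<Suc k]])"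
    using transport by (simp add: sum_subtractf)
  finally show ?thesis .
qed

theorem mainTheorem11:
  fixes D :: "complex set" and x y :: real and N k :: nat and a :: "nat \<Rightarrow> complex"
  assumes "finite D"
    and "x \<in> \<rat>" and "y \<in> \<rat>"
    and "complex_of_real x \<in> D" and "complex_of_real y \<in> D"
    and "x < y"
    and "complex_of_real ` {x<..<y} \<inter> D = {}"
    and "N > 0" and "even N"
    and "x * real N \<in> \<int>" and "y * real N \<in> \<int>"
    and "k \<ge> 2"
    and "\<And>i. i \<in> {1..k} \<Longrightarrow> a i \<in> D"
  shows "(\<Sum>i | i \<in> {1..k} \<and> a i \<noteq> complex_of_real x.
            Delta N x y (seg a i k @ seg a 1 (i - 1) @ [[complex_of_real x]]))
       + (\<Sum>i | i \<in> {1..k} \<and> a i \<noteq> complex_of_real y.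
            Delta N x y ([[complex_of_real y]] @ seg a (i + 1) k @ seg a 1 (i - 1) @ [[a i]]))
       = (\<Sum>i | i \<in> {1..k} \<and> a i \<notin> {complex_of_real x, complex_of_real y}.
            Delta N x y (seg a i k @ seg a 1 i))
       - (\<Sum>i = 1..k. Delta N x y [map a [1..<Suc i] @ map a [i..<Suc k]])"
proof -
  let ?x = "complex_of_real x" and ?y = "complex_of_real y"
  let ?A = "\<lambda>i. Delta N x y (seg a i k @ seg a 1 (i - 1) @ [[?x]])"
  let ?B = "\<lambda>i. Delta N x y ([[?y]] @ seg a (i + 1) k @ seg a 1 (i - 1) @ [[a i]])"
  let ?C = "\<lambda>i. Delta N x y (seg a i k @ seg a 1 i)"
  have seg_last: "seg a 1 i = seg a 1 (i - 1) @ [[a i]]" if "i \<in> {1..k}" for i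
    using that by (simp add: seg_eq_snoc)
  have A: "?A i = ?C i" if "i \<in> {1..k}" "a i = ?x" for i
    using seg_last[of i] that by simp
  have B: "?B i = ?C i" if "i \<in> {1..k}" "a i = ?y" for i
  proof -
    have "seg a i k = [a i] # seg a (i + 1) k"
      using that by (simp add: seg_eq_Cons)
    with seg_last[of i] that show ?thesis
      by simp
  qed
  have filter: "(\<Sum>i | i \<in> {1..k} \<and> P i. f i) = (\<Sum>i=1..k. if P i then f i else 0)"
    for P and f :: "nat \<Rightarrow> complex"
    using sum.inter_filter[of "{1..k}" f P] by simp
  have full: "(\<Sum>i=1..k. ?A i) + (\<Sum>i=1..k. ?B i) = (\<Sum>i=1..k. ?C i)
      - (\<Sum>i = 1..k. Delta N x y [map a [1..<Suc i] @ map a [i..<Suc k]])"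
    by (rule cyclic_sum_unrestricted) (fact | fact of_int_ne_of_gap[OF assms(13,7,8)])+
  have "(\<Sum>i | i \<in> {1..k} \<and> a i \<noteq> ?x. ?A i) + (\<Sum>i | i \<in> {1..k} \<and> a i \<noteq> ?y. ?B i)
      - (\<Sum>i | i \<in> {1..k} \<and> a i \<notin> {?x, ?y}. ?C i)
      = (\<Sum>i=1..k. (if a i \<noteq> ?x then ?A i else 0) + (if a i \<noteq> ?y then ?B i else 0)
          - (if a i \<notin> {?x, ?y} then ?C i else 0))"
    unfolding filter by (simp only: sum.distrib sum_subtractf)
  \<comment> \<open>If \<open>a i = ?x\<close>, the equal terms \<open>?A i\<close> and
    \<open>?C i\<close> are dropped together; if \<open>a i = ?y\<close>, so are \<open>?B i\<close>
    and \<open>?C i\<close>. As \<open>x < y\<close>, the two cases exclude each other.\<close>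
  also have "\<dots> = (\<Sum>i=1..k. ?A i + ?B i - ?C i)"
    by (rule sum.cong[OF refl]) (use A B \<open>x < y\<close> in auto)
  also have "\<dots> = (\<Sum>i=1..k. ?A i) + (\<Sum>i=1..k. ?B i) - (\<Sum>i=1..k. ?C i)"
    by (simp only: sum.distrib sum_subtractf)
  also have "\<dots> = - (\<Sum>i = 1..k. Delta N x y [map a [1..<Suc i] @ map a [i..<Suc k]])"
    unfolding full by simp
  finally show ?thesis
    by (simp add: algebra_simps)
qed

end
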